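(* Let $m\ge1$, $\theta\ge 2$, and let $f\in W^{1,\infty}_{\mathrm{loc}}(\mathbb{R}^m)$ be coercive, i.e. $f(x)\to+\infty$ as $|x|\to+\infty$. If $(\lambda_1,\phi)$ and $(\lambda_2,\psi)$ are two solutions of $(EP)$ such that $\phi$ and $\psi$ are bounded from below, then $\lambda_1=\lambda_2$ and there exists a constant $C\in\mathbb{R}$ such that $\phi=\psi+C$ in $\mathbb{R}^m$.
   Context: A pair $(\lambda,\phi)\in\mathbb{R}\times C^2(\mathbb{R}^m)$ is a solution of $(EP)$ if $-\frac12\Delta\phi(y)+\frac1\theta|D\phi(y)|^\theta=f(y)-\lambda$ for all $y\in\mathbb{R}^m$. $W^{1,\infty}_{\mathrm{loc}}(\mathbb{R}^m)$ is identified with the space of locally Lipschitz continuous functions. *)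

theory Defs
  imports "HOL-Analysis.Analysis"
begin

text \<open>
  Partial derivatives are taken from the total derivative and are therefore meaningful only at
  points of differentiability; \<^term>\<open>frechet_derivative\<close> is an unspecified value elsewhere. They
  are only used below under such an assumption.
\<close>

definition partial :: "'m::finite \<Rightarrow> (real ^ 'm \<Rightarrow> real) \<Rightarrow> real ^ 'm \<Rightarrow> real" where
  "partial i u x = frechet_derivative u (at x) (axis i 1)"

definition gradient :: "(real ^ 'm::finite \<Rightarrow> real) \<Rightarrow> real ^ 'm \<Rightarrow> real ^ 'm" where
  "gradient u x = (\<chi> i. partial i u x)"

definition laplacian :: "(real ^ 'm::finite \<Rightarrow> real) \<Rightarrow> real ^ 'm \<Rightarrow> real" where
  "laplacian u x = (\<Sum>i\<in>UNIV. partial i (partial i u) x)"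

definition C1 :: "(real ^ 'm::finite \<Rightarrow> real) \<Rightarrow> bool" where
  "C1 u \<longleftrightarrow> (\<forall>x. u differentiable (at x)) \<and> (\<forall>i. continuous_on UNIV (partial i u))"

definition C2 :: "(real ^ 'm::finite \<Rightarrow> real) \<Rightarrow> bool" where
  "C2 u \<longleftrightarrow> C1 u \<and> (\<forall>i. C1 (partial i u))"

text \<open>
  The space \<open>W^{1,\<infinity>}_loc\<close> is identified with the locally Lipschitz continuous functions. The
  library's \<^term>\<open>local_lipschitz\<close> is the same notion for families with a time parameter.
\<close>

definition locally_Lipschitz :: "(real ^ 'm::finite \<Rightarrow> real) \<Rightarrow> bool" where
  "locally_Lipschitz f \<longleftrightarrow> (\<forall>x. \<exists>r>0. \<exists>L. L-lipschitz_on (cball x r) f)"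

definition coercive :: "(real ^ 'm::finite \<Rightarrow> real) \<Rightarrow> bool" where
  "coercive f \<longleftrightarrow> filterlim f at_top at_infinity"

definition is_solution_EP ::
    "real \<Rightarrow> (real ^ 'm::finite \<Rightarrow> real) \<Rightarrow> real \<Rightarrow> (real ^ 'm \<Rightarrow> real) \<Rightarrow> bool" where
  "is_solution_EP \<theta> f lam u \<longleftrightarrow> C2 u \<and>
     (\<forall>y. - (1 / 2) * laplacian u y + (1 / \<theta>) * norm (gradient u y) powr \<theta> = f y - lam)"

end

theory Submission
  imports Defs
begin

text \<open>
  The solutions cannot be compared at infinity directly, because both are unbounded and nothing
  controls the growth of \<open>\<phi> - \<psi>\<close>. The substitution \<open>v = exp (- \<phi>)\<close>
  removes this obstacle. A solution bounded from below tends to infinity (\<open>solution_coercive\<close>):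
  where \<open>f\<close> is huge, the equation forbids a concave paraboloid of given height over a unit ball to
  touch \<open>\<phi>\<close> from below. Hence \<open>v\<close>
  vanishes at infinity, and if \<open>exp (- \<phi>) - exp (- \<psi> - c)\<close> is positive somewhere, it attains its
  maximum. In terms of \<open>v\<close> the equation reads
  \<open>\<Delta>v / 2 = v (f - \<lambda>) + |Dv|^2 / (2 v) - v^(1 - \<theta>) |Dv|^\<theta> / \<theta>\<close>, and for \<open>\<theta> \<ge> 2\<close> its right-hand
  side is increasing in \<open>v\<close> at fixed \<open>Dv\<close> wherever \<open>f - \<lambda>\<close> exceeds a constant. So a positive maximum
  can only lie in a ball. Choosing \<open>c\<close> as the minimum of \<open>\<phi> - \<psi>\<close> over this ball excludes
  it altogether, and \<open>\<phi> - \<psi>\<close> attains a global minimum (\<open>difference_attains_min\<close>). The argument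
  needs \<open>\<lambda>\<^sub>1 \<le> \<lambda>\<^sub>2\<close>, which is no restriction by symmetry.

  At the global minimum the gradients agree and the Laplacians are ordered, so the equations give
  \<open>\<lambda>\<^sub>2 \<le> \<lambda>\<^sub>1\<close> (\<open>eigenvalue_ge_at_min\<close>); therefore \<open>\<lambda>\<^sub>1 = \<lambda>\<^sub>2\<close>. Now \<open>u = \<phi> - \<psi>\<close> satisfies
  \<open>\<Delta>u \<le> C |Du|\<close> on every ball, since \<open>p \<mapsto> |p|^\<theta>\<close> is Lipschitz on bounded sets, and Hopf's
  \<open>strong_minimum_principle\<close> makes it constant.
\<close>

section \<open>Derivatives along coordinate lines\<close>

lemma second_derivative_test_min:
  fixes w dw :: "real \<Rightarrow> real"
  assumes "e > 0" and min: "\<And>t. \<bar>t\<bar> < e \<Longrightarrow> w 0 \<le> w t"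
    and d1: "\<And>t. (w has_real_derivative dw t) (at t)"
    and d2: "(dw has_real_derivative b) (at 0)"
  shows "dw 0 = 0" and "b \<ge> 0"
proof -
  show dw0: "dw 0 = 0"
    using DERIV_local_min[OF d1[of 0] \<open>e > 0\<close>] min by simp
  show "b \<ge> 0"
  proof (rule ccontr)
    assume "\<not> b \<ge> 0"
    then obtain d where "d > 0" and d: "\<And>h. 0 < h \<Longrightarrow> h < d \<Longrightarrow> dw h < 0"
      using DERIV_neg_dec_right[OF d2] dw0 by auto
    define s where "s = min d e / 2"
    have s: "0 < s" "s < d" "s < e"
      using \<open>d > 0\<close> \<open>e > 0\<close> by (auto simp: s_def min_def)
    obtain z where "0 < z" "z < s" "w s - w 0 = (s - 0) * dw z"
      using MVT2[OF s(1), of w dw] d1 by blast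
    moreover have "dw z < 0"
      using d[of z] \<open>0 < z\<close> \<open>z < s\<close> s by simp
    ultimately have "w s < w 0"
      using s mult_pos_neg[of s "dw z"] by simp
    with min[of s] s show False by simp
  qed
qed

text \<open>
  Every touching argument below ends here. The hypotheses speak of derivatives along coordinate
  lines only, so that test functions such as paraboloids and Gaussians, and compositions such as
  \<open>exp (- \<phi>)\<close>, can be treated by one-variable calculus.
\<close>

lemma coordinate_derivatives_local_min:
  fixes w :: "real ^ 'm::finite \<Rightarrow> real"
  assumes "e > 0" and min: "\<And>y. y \<in> ball x e \<Longrightarrow> w x \<le> w y"
    and d1: "\<And>i t. ((\<lambda>t. w (x + t *\<^sub>R axis i 1)) has_real_derivative dw i t) (at t)"
    and d2: "\<And>i. (dw i has_real_derivative ddw i) (at 0)"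
  shows "dw i 0 = 0" and "ddw i \<ge> 0"
proof -
  have "w (x + 0 *\<^sub>R axis i 1) \<le> w (x + t *\<^sub>R axis i 1)" if "\<bar>t\<bar> < e" for t
    using min[of "x + t *\<^sub>R axis i 1"] that by (simp add: dist_norm norm_axis_1)
  then show "dw i 0 = 0" "ddw i \<ge> 0"
    using second_derivative_test_min[OF \<open>e > 0\<close> _ d1 d2] by blast+
qed

lemma partial_diff:
  assumes "u differentiable (at x)" "v differentiable (at x)"
  shows "partial i (\<lambda>y. u y - v y) x = partial i u x - partial i v x"
proof -
  have "((\<lambda>y. u y - v y) has_derivative
      (\<lambda>h. frechet_derivative u (at x) h - frechet_derivative v (at x) h)) (at x)"
    using assms by (intro has_derivative_diff) (simp_all add: frechet_derivative_works[symmetric])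
  then show ?thesis
    unfolding partial_def by (metis frechet_derivative_at)
qed

lemma C1_line_derivative:
  assumes "C1 u"
  shows "((\<lambda>t. u (x + t *\<^sub>R axis i 1)) has_real_derivative partial i u (x + t *\<^sub>R axis i 1)) (at t)"
proof -
  let ?D = "frechet_derivative u (at (x + t *\<^sub>R axis i 1))"
  have D: "(u has_derivative ?D) (at (x + t *\<^sub>R axis i 1))"
    using assms by (simp add: C1_def frechet_derivative_works[symmetric])
  have "((\<lambda>t. u (x + t *\<^sub>R axis i 1)) has_derivative (\<lambda>s. ?D (s *\<^sub>R axis i 1))) (at t)"
    by (rule has_derivative_compose[where f = "\<lambda>t. x + t *\<^sub>R axis i 1" and g = u, OF _ D])
       (auto intro!: derivative_eq_intros)
  then show ?thesis
    unfolding has_field_derivative_def partial_def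
    by (rule has_derivative_eq_rhs)
       (simp add: fun_eq_iff linear_scale[OF has_derivative_linear[OF D]] mult.commute)
qed

lemma C2_line_derivatives:
  assumes "C2 u"
  shows "((\<lambda>t. u (x + t *\<^sub>R axis i 1)) has_real_derivative partial i u (x + t *\<^sub>R axis i 1)) (at t)"
    and "((\<lambda>t. partial i u (x + t *\<^sub>R axis i 1)) has_real_derivative
      partial i (partial i u) (x + t *\<^sub>R axis i 1)) (at t)"
  using assms C1_line_derivative unfolding C2_def by blast+

lemma C1_imp_continuous_on: "C1 u \<Longrightarrow> continuous_on S u"
  by (simp add: C1_def continuous_at_imp_continuous_on differentiable_imp_continuous_within)

lemma C1_diff:
  assumes "C1 u" "C1 v"
  shows "C1 (\<lambda>x. u x - v x)"
proof -
  have "partial i (\<lambda>x. u x - v x) = (\<lambda>x. partial i u x - partial i v x)" for i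
    using assms by (auto simp: C1_def partial_diff)
  with assms show ?thesis
    by (auto simp: C1_def intro!: continuous_on_diff differentiable_diff)
qed

lemma C2_diff:
  assumes "C2 u" "C2 v"
  shows "C2 (\<lambda>x. u x - v x)"
    and "gradient (\<lambda>x. u x - v x) x = gradient u x - gradient v x"
    and "laplacian (\<lambda>x. u x - v x) x = laplacian u x - laplacian v x"
proof -
  have p: "partial i (\<lambda>x. u x - v x) = (\<lambda>x. partial i u x - partial i v x)" for i
    using assms by (auto simp: C1_def C2_def partial_diff)
  show "C2 (\<lambda>x. u x - v x)"
    using assms by (auto simp: C2_def p intro!: C1_diff)
  show "gradient (\<lambda>x. u x - v x) x = gradient u x - gradient v x"
    by (simp add: gradient_def p vec_eq_iff)
  show "laplacian (\<lambda>x. u x - v x) x = laplacian u x - laplacian v x"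
    using assms by (simp add: laplacian_def p C1_def C2_def partial_diff sum_subtractf)
qed

lemma C2_imp_continuous_on_gradient: "C2 u \<Longrightarrow> continuous_on S (gradient u)"
  unfolding gradient_def C2_def C1_def
  by (intro continuous_on_vec_lambda) (meson continuous_on_subset top_greatest)

lemma norm_sq_along_axis:
  fixes x y :: "real ^ 'm::finite"
  shows "(norm (x + t *\<^sub>R axis i 1 - y))\<^sup>2 = (norm (x - y))\<^sup>2 + 2 * t * (x - y) $ i + t\<^sup>2"
proof -
  have "x + t *\<^sub>R axis i 1 - y = (x - y) + t *\<^sub>R axis i 1" by simp
  then show ?thesis
    by (simp only: power2_norm_eq_inner)
       (simp add: inner_add_left inner_add_right inner_axis inner_axis' inner_axis_axis
          inner_commute power2_eq_square algebra_simps)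
qed

lemma sum_squares_gradient: "(\<Sum>i\<in>UNIV. (partial i u x)\<^sup>2) = (norm (gradient u x))\<^sup>2"
  by (simp add: gradient_def norm_vec_def L2_set_def sum_nonneg)

section \<open>The strong minimum principle\<close>

text \<open>
  Hopf's argument. If \<open>u\<close> is not constant, some ball in which \<open>u\<close> exceeds its minimum touches the
  minimum set \<open>Z\<close> at exactly one point \<open>z\<close>. The barrier \<open>h = exp (- \<alpha> |x - c|\<^sup>2) - exp (- \<alpha> r\<^sup>2)\<close> is
  positive inside this ball, negative outside and zero at \<open>z\<close>, and for large \<open>\<alpha>\<close> it satisfies
  \<open>\<Delta>h > C |Dh|\<close> near \<open>z\<close>. On a small sphere about \<open>z\<close>, \<open>u - \<epsilon> h\<close> lies above its value at \<open>z\<close>, so it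
  has an interior minimum, where \<open>Du = \<epsilon> Dh\<close> and \<open>\<Delta>u \<ge> \<epsilon> \<Delta>h\<close> contradict \<open>\<Delta>u \<le> C |Du|\<close>.
\<close>

lemma strong_minimum_principle:
  fixes u :: "real ^ 'm::finite \<Rightarrow> real"
  assumes u: "C2 u" and min: "\<And>y. u x0 \<le> u y"
    and ineq: "\<And>x r. \<exists>C. \<forall>y\<in>cball x r. laplacian u y \<le> C * norm (gradient u y)"
  shows "u y = u x0"
proof (rule ccontr)
  assume neq: "u y \<noteq> u x0"
  define Z where "Z = {x. u x = u x0}"
  have cont: "continuous_on S u" for S
    using u by (simp add: C2_def C1_imp_continuous_on)
  have "closed Z"
    using continuous_closed_vimage[of "{u x0}" u] cont[of UNIV]
    by (simp add: Z_def vimage_def continuous_on_eq_continuous_at)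
  moreover have "x0 \<in> Z" by (simp add: Z_def)
  ultimately obtain z where z: "z \<in> Z" and near: "\<And>x. x \<in> Z \<Longrightarrow> dist y z \<le> dist y x"
    using distance_attains_inf[of Z y] by blast
  define c where "c = (1/2) *\<^sub>R (y + z)"
  define r where "r = dist y z / 2"
  have "y \<notin> Z" using neq by (simp add: Z_def)
  then have "r > 0" using z by (auto simp: r_def)
  have dcz: "dist c z = r" and dyc: "dist y c = r"
  proof -
    have "c - z = (1/2) *\<^sub>R (y - z)" "y - c = (1/2) *\<^sub>R (y - z)"
      by (simp_all add: c_def vec_eq_iff algebra_simps)
    then show "dist c z = r" "dist y c = r"
      by (simp_all add: dist_norm r_def)
  qed
  (* The ball about y of radius dist y z may touch Z in many points. Halving it towards z leaves z
     only: any other touching point would make the triangle inequality between y, c and it strict. *)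
  have only: "x = z" if "x \<in> Z" "dist c x \<le> r" for x
  proof -
    have "dist y x = dist y c + dist c x"
      using near[OF \<open>x \<in> Z\<close>] dist_triangle[of y x c] that dyc by (simp add: r_def)
    moreover from this have "dist c x = r"
      using near[OF \<open>x \<in> Z\<close>] that dyc by (simp add: r_def)
    ultimately have "norm (y - c) *\<^sub>R (c - x) = norm (c - x) *\<^sub>R (y - c)"
      using norm_triangle_eq[of "y - c" "c - x"] by (simp add: dist_norm)
    then have "c - x = y - c"
      using dyc \<open>dist c x = r\<close> \<open>r > 0\<close> by (simp add: dist_norm)
    moreover have "c - z = y - c"
      by (simp add: c_def vec_eq_iff field_simps)
    ultimately show "x = z" by (metis add_diff_cancel_left' diff_add_cancel diff_diff_eq2)
  qed
  (* A radius below r keeps c away from the small ball, so Dh does not vanish on it. *)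
  define \<rho> where "\<rho> = r / 2"
  obtain C0 where C0: "\<And>x. x \<in> cball z \<rho> \<Longrightarrow> laplacian u x \<le> C0 * norm (gradient u x)"
    using ineq[of z \<rho>] by blast
  define C where "C = max C0 0"
  have C: "laplacian u x \<le> C * norm (gradient u x)" if "x \<in> cball z \<rho>" for x
    using C0[OF that] mult_right_mono[of C0 C "norm (gradient u x)"] by (simp add: C_def)
  let ?m = "real CARD('m)"
  (* Chosen so that 2 * \<alpha> * s^2 > m + C * s for all distances s to c between \<rho> and 2 * r, which is
     the inequality \<Delta>h > C |Dh| divided by 2 * \<alpha> * exp (- \<alpha> * s^2). *)
  define \<alpha> where "\<alpha> = (?m + 2 * C * r + 1) / (2 * \<rho>\<^sup>2)"
  have "\<rho> > 0" "C \<ge> 0" using \<open>r > 0\<close> by (simp_all add: \<rho>_def C_def)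
  then have "\<alpha> > 0" and \<alpha>: "2 * \<alpha> * \<rho>\<^sup>2 = ?m + 2 * C * r + 1"
    using \<open>r > 0\<close> by (auto simp: \<alpha>_def intro!: divide_pos_pos add_nonneg_pos add_nonneg_nonneg)
  define h where "h x = exp (- \<alpha> * (norm (x - c))\<^sup>2) - exp (- \<alpha> * r\<^sup>2)" for x
  have conth: "continuous_on S h" for S
    unfolding h_def by (intro continuous_intros)
  have "h z = 0" using dcz by (simp add: h_def dist_norm norm_minus_commute)
  have hneg: "h x < 0" if "dist c x > r" for x
    using that \<open>r > 0\<close> \<open>\<alpha> > 0\<close> by (simp add: h_def dist_norm norm_minus_commute power_strict_mono)
  have hle: "h x \<le> 1" for x
  proof -
    have "exp (- \<alpha> * (norm (x - c))\<^sup>2) \<le> 1" using \<open>\<alpha> > 0\<close> by simp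
    then show ?thesis by (simp add: h_def add_increasing2 less_imp_le algebra_simps)
  qed
  (* On the part K of the small sphere where h may be positive, u stays away from its minimum. *)
  define K where "K = sphere z \<rho> \<inter> cball c r"
  obtain \<epsilon> where "\<epsilon> > 0" and \<epsilon>: "\<And>x. x \<in> K \<Longrightarrow> \<epsilon> < u x - u x0"
  proof (cases "K = {}")
    case True
    then show thesis using that[of 1] by simp
  next
    case False
    have "compact K" unfolding K_def by (intro compact_Int_closed compact_sphere closed_cball)
    then obtain k where k: "k \<in> K" "\<And>x. x \<in> K \<Longrightarrow> u k \<le> u x"
      using continuous_attains_inf[OF _ False cont] by blast
    have "k \<notin> Z" using k only[of k] \<open>\<rho> > 0\<close> by (auto simp: K_def)
    then have "u x0 < u k" using min[of k] by (simp add: Z_def)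
    then show thesis
      using that[of "(u k - u x0) / 2"] k(2) by (force simp: field_simps)
  qed
  define w where "w x = u x - \<epsilon> * h x" for x
  have "compact (cball z \<rho>)" "cball z \<rho> \<noteq> {}" using \<open>\<rho> > 0\<close> by auto
  moreover have "continuous_on (cball z \<rho>) w"
    unfolding w_def by (intro continuous_intros cont conth)
  ultimately obtain p where p: "p \<in> cball z \<rho>" and pmin: "\<And>x. x \<in> cball z \<rho> \<Longrightarrow> w p \<le> w x"
    using continuous_attains_inf[of "cball z \<rho>" w] by blast
  have wz: "w z = u x0" using z \<open>h z = 0\<close> by (simp add: w_def Z_def)
  have "p \<notin> sphere z \<rho>"
  proof
    assume sp: "p \<in> sphere z \<rho>"
    have "u x0 < w p"
    proof (cases "dist c p \<le> r")
      case True
      then have "\<epsilon> < u p - u x0" using \<epsilon>[of p] sp by (simp add: K_def)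
      then show ?thesis
        using mult_left_mono[OF hle[of p], of \<epsilon>] \<open>\<epsilon> > 0\<close> unfolding w_def by linarith
    next
      case False
      then have "\<epsilon> * h p < 0" using hneg[of p] \<open>\<epsilon> > 0\<close> by (simp add: mult_pos_neg)
      then show ?thesis using min[of p] by (simp add: w_def)
    qed
    then show False using pmin[of z] wz \<open>\<rho> > 0\<close> by simp
  qed
  then have "p \<in> ball z \<rho>" using p by auto
  then obtain e where "e > 0" and e: "ball p e \<subseteq> ball z \<rho>"
    using openE[OF open_ball] by blast
  define E where "E = exp (- \<alpha> * (norm (p - c))\<^sup>2)"
  define s where "s = norm (p - c)"
  define E' where "E' i t = exp (- \<alpha> * ((norm (p - c))\<^sup>2 + 2 * t * (p - c) $ i + t\<^sup>2))" for i t
  define dw where "dw i t = partial i u (p + t *\<^sub>R axis i 1)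
      - \<epsilon> * (E' i t * (- \<alpha> * (2 * (p - c) $ i + 2 * t)))" for i t
  define ddw where "ddw i = partial i (partial i u) p
      - \<epsilon> * (E * ((2 * \<alpha> * (p - c) $ i)\<^sup>2 - 2 * \<alpha>))" for i
  have d1: "((\<lambda>t. w (p + t *\<^sub>R axis i 1)) has_real_derivative dw i t) (at t)" for i t
    unfolding w_def h_def norm_sq_along_axis dw_def E'_def
    by (rule derivative_eq_intros C2_line_derivatives(1)[OF u] refl)+ (simp add: algebra_simps)
  have d2: "(dw i has_real_derivative ddw i) (at 0)" for i
    unfolding dw_def ddw_def E'_def E_def
    by (rule derivative_eq_intros C2_line_derivatives(2)[OF u] refl)+
       (simp add: power2_eq_square algebra_simps)
  have wmin: "w p \<le> w x" if "x \<in> ball p e" for x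
    using pmin[of x] that e by (meson ball_subset_cball subsetD)
  note crit = coordinate_derivatives_local_min[OF \<open>e > 0\<close> wmin d1 d2]
  have "gradient u p = (- 2 * \<alpha> * \<epsilon> * E) *\<^sub>R (p - c)"
    using crit(1) by (simp add: vec_eq_iff gradient_def dw_def E'_def E_def algebra_simps)
  moreover have "E > 0" by (simp add: E_def)
  ultimately have ng: "norm (gradient u p) = 2 * \<alpha> * \<epsilon> * E * s"
    using \<open>\<alpha> > 0\<close> \<open>\<epsilon> > 0\<close> by (simp add: s_def)
  have "0 \<le> (\<Sum>i\<in>UNIV. ddw i)" using crit(2) by (simp add: sum_nonneg)
  also have "\<dots> = laplacian u p - \<epsilon> * (E * (4 * \<alpha>\<^sup>2 * s\<^sup>2 - 2 * \<alpha> * ?m))"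
  proof -
    have "s\<^sup>2 = (\<Sum>i\<in>UNIV. ((p - c) $ i)\<^sup>2)"
      by (simp add: s_def norm_vec_def L2_set_def sum_nonneg)
    moreover have "ddw i = partial i (partial i u) p
        - ((4 * \<epsilon> * E * \<alpha>\<^sup>2) * ((p - c) $ i)\<^sup>2 - 2 * \<epsilon> * E * \<alpha>)" for i
      by (simp add: ddw_def power2_eq_square algebra_simps)
    ultimately have "(\<Sum>i\<in>UNIV. ddw i)
        = laplacian u p - ((4 * \<epsilon> * E * \<alpha>\<^sup>2) * s\<^sup>2 - ?m * (2 * \<epsilon> * E * \<alpha>))"
      by (simp only: sum_subtractf sum_distrib_left[symmetric] laplacian_def sum_constant)
         (simp only: mult_ac)
    then show ?thesis
      by (simp add: algebra_simps)
  qed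
  finally have "\<epsilon> * (E * (4 * \<alpha>\<^sup>2 * s\<^sup>2 - 2 * \<alpha> * ?m)) \<le> C * (2 * \<alpha> * \<epsilon> * E * s)"
    using C[OF p] ng by simp
  then have "(2 * \<alpha> * \<epsilon> * E) * (2 * \<alpha> * s\<^sup>2 - ?m) \<le> (2 * \<alpha> * \<epsilon> * E) * (C * s)"
    by (simp add: power2_eq_square algebra_simps)
  then have "2 * \<alpha> * s\<^sup>2 - ?m \<le> C * s"
    using \<open>\<alpha> > 0\<close> \<open>\<epsilon> > 0\<close> \<open>E > 0\<close> by simp
  moreover have "\<rho> \<le> s" "s \<le> 2 * r"
    using p dcz dist_triangle[of c z p] dist_triangle[of c p z] \<open>r > 0\<close>
    by (simp_all add: s_def \<rho>_def dist_norm norm_minus_commute)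
  then have "2 * \<alpha> * \<rho>\<^sup>2 \<le> 2 * \<alpha> * s\<^sup>2" "C * s \<le> C * (2 * r)"
    using \<open>\<alpha> > 0\<close> \<open>\<rho> > 0\<close> \<open>C \<ge> 0\<close> by (auto intro: mult_left_mono power_mono)
  ultimately show False using \<alpha> by simp
qed

section \<open>Solutions bounded from below tend to infinity\<close>

lemma solution_C2_laplacian:
  assumes "is_solution_EP \<theta> f lam u"
  shows "C2 u"
    and "laplacian u y = (2 / \<theta>) * norm (gradient u y) powr \<theta> - 2 * (f y - lam)"
proof -
  show "C2 u" using assms by (simp add: is_solution_EP_def)
  have "- (1 / 2) * laplacian u y + (1 / \<theta>) * norm (gradient u y) powr \<theta> = f y - lam"
    using assms by (simp add: is_solution_EP_def)
  then show "laplacian u y = (2 / \<theta>) * norm (gradient u y) powr \<theta> - 2 * (f y - lam)"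
    by (simp add: field_simps)
qed

text \<open>
  Given a lower bound \<open>b\<close> of \<open>\<phi>\<close>, the paraboloid \<open>b + A (1 - |x - x0|\<^sup>2)\<close> lies below \<open>\<phi>\<close> on the unit
  sphere about \<open>x0\<close>. At an interior minimum of the difference, the equation would bound \<open>f - \<lambda>\<close> by the
  constant \<open>K\<close> below, which fails when \<open>x0\<close> is far out. Hence \<open>\<phi> x0 \<ge> b + A\<close>.
\<close>

lemma solution_coercive:
  fixes f \<phi> :: "real ^ 'm::finite \<Rightarrow> real"
  assumes "\<theta> > 0" "coercive f" and sol: "is_solution_EP \<theta> f lam \<phi>" and "bdd_below (range \<phi>)"
  shows "filterlim \<phi> at_top at_infinity"
  unfolding filterlim_at_top
proof
  fix Y :: real
  obtain b where b: "\<And>x. b \<le> \<phi> x"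
    using \<open>bdd_below (range \<phi>)\<close> by (auto simp: bdd_below_def)
  have C2: "C2 \<phi>" and eq: "\<And>y. - (1 / 2) * laplacian \<phi> y
      + (1 / \<theta>) * norm (gradient \<phi> y) powr \<theta> = f y - lam"
    using sol by (auto simp: is_solution_EP_def)
  define A where "A = max 0 (Y - b)"
  have "A \<ge> 0" by (simp add: A_def)
  let ?m = "real CARD('m)"
  define K where "K = ?m * A + (1 / \<theta>) * (2 * A) powr \<theta>"
  have "eventually (\<lambda>x. lam + K < f x) at_infinity"
    using \<open>coercive f\<close> by (simp add: coercive_def filterlim_at_top_dense)
  then obtain R where R: "\<And>x. R \<le> norm x \<Longrightarrow> lam + K < f x"
    by (auto simp: eventually_at_infinity)
  have "Y \<le> \<phi> x0" if "R + 1 \<le> norm x0" for x0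
  proof -
    define w where "w x = \<phi> x + A * (norm (x - x0))\<^sup>2" for x
    have "continuous_on (cball x0 1) w"
      unfolding w_def using C2 by (intro continuous_intros C1_imp_continuous_on) (simp add: C2_def)
    then obtain p where p: "p \<in> cball x0 1" and pmin: "\<And>x. x \<in> cball x0 1 \<Longrightarrow> w p \<le> w x"
      using continuous_attains_inf[of "cball x0 1" w] by auto
    have "p \<notin> ball x0 1"
    proof
      assume "p \<in> ball x0 1"
      then obtain e where "e > 0" and e: "ball p e \<subseteq> ball x0 1"
        using openE[OF open_ball] by blast
      define dw where "dw i t = partial i \<phi> (p + t *\<^sub>R axis i 1)
          + A * (2 * (p - x0) $ i + 2 * t)" for i t
      define ddw where "ddw i = partial i (partial i \<phi>) p + 2 * A" for i
      have d1: "((\<lambda>t. w (p + t *\<^sub>R axis i 1)) has_real_derivative dw i t) (at t)" for i t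
        unfolding w_def norm_sq_along_axis dw_def
        by (rule derivative_eq_intros C2_line_derivatives(1)[OF C2] refl)+ simp
      have d2: "(dw i has_real_derivative ddw i) (at 0)" for i
        unfolding dw_def ddw_def
        by (rule derivative_eq_intros C2_line_derivatives(2)[OF C2] refl)+ simp
      have wmin: "w p \<le> w x" if "x \<in> ball p e" for x
        using pmin[of x] that e by (meson ball_subset_cball subsetD)
      note crit = coordinate_derivatives_local_min[OF \<open>e > 0\<close> wmin d1 d2]
      have "gradient \<phi> p = (- 2 * A) *\<^sub>R (p - x0)"
        using crit(1) by (simp add: vec_eq_iff gradient_def dw_def algebra_simps)
      then have "norm (gradient \<phi> p) = 2 * A * norm (p - x0)"
        using \<open>A \<ge> 0\<close> by simp
      also have "\<dots> \<le> 2 * A"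
        using p \<open>A \<ge> 0\<close> by (simp add: mult_left_le dist_norm norm_minus_commute)
      finally have "(1 / \<theta>) * norm (gradient \<phi> p) powr \<theta> \<le> (1 / \<theta>) * (2 * A) powr \<theta>"
        using \<open>\<theta> > 0\<close> by (intro mult_left_mono powr_mono2) auto
      moreover have "0 \<le> laplacian \<phi> p + 2 * A * ?m"
        using sum_nonneg[of UNIV ddw] crit(2)
        by (simp add: ddw_def laplacian_def sum.distrib mult_ac)
      ultimately have "f p - lam \<le> K"
        using eq[of p] by (simp add: K_def algebra_simps)
      moreover have "R \<le> norm p"
        using p that norm_triangle_sub[of x0 p] by (simp add: dist_norm)
      ultimately show False using R[of p] by simp
    qed
    then have "norm (p - x0) = 1" using p by (simp add: dist_norm norm_minus_commute)
    then have "b + A \<le> w p" using b[of p] by (simp add: w_def)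
    also have "w p \<le> \<phi> x0" using pmin[of x0] by (simp add: w_def)
    finally show ?thesis by (simp add: A_def)
  qed
  then show "eventually (\<lambda>x. Y \<le> \<phi> x) at_infinity"
    by (auto simp: eventually_at_infinity)
qed

section \<open>Inequalities for powers\<close>

lemma square_le_powr:
  fixes q :: real
  assumes "\<theta> \<ge> 2" "q \<ge> 0"
  shows "q\<^sup>2 \<le> (2 / \<theta>) * q powr \<theta> + 1"
proof (cases "\<theta> = 2")
  case True
  then show ?thesis using assms by (cases "q = 0") (simp_all add: powr_numeral)
next
  case False
  then have "q\<^sup>2 * 1 \<le> (q\<^sup>2) powr (\<theta> / 2) / (\<theta> / 2) + 1 powr (\<theta> / (\<theta> - 2)) / (\<theta> / (\<theta> - 2))"
    using assms by (intro Youngs_inequality) (auto simp: field_simps)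
  moreover have "(q\<^sup>2) powr (\<theta> / 2) = q powr \<theta>"
  proof (cases "q = 0")
    case False
    then have "q\<^sup>2 = q powr 2" using assms by (simp add: powr_numeral)
    then show ?thesis by (simp add: powr_powr)
  qed simp
  moreover have "(\<theta> - 2) / \<theta> \<le> 1" using assms by (simp add: field_simps)
  ultimately show ?thesis by (simp add: mult.commute)
qed

text \<open>
  The monotonicity in \<open>v\<close> of the equation for \<open>v = exp (- \<phi>)\<close>, in scalar form. Here \<open>t\<close> is the quotient
  of the two values of \<open>v\<close>, \<open>q\<close> and \<open>t * q\<close> are the norms of the gradients of \<open>\<psi>\<close> and \<open>\<phi>\<close>, and \<open>a\<close> is
  \<open>f - \<lambda>\<close>. As \<open>\<theta> \<ge> 2\<close>, a factor \<open>1 - t\<close> can be extracted from \<open>t - t powr \<theta>\<close>, and the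
  superquadratic term then absorbs \<open>q\<^sup>2\<close>.
\<close>

lemma exterior_gradient_inequality:
  fixes a t q :: real
  assumes "\<theta> \<ge> 2" "0 < t" "t < 1" "q \<ge> 0"
    and "2 * (1 - t) * a \<le> t * (1 - t) * q\<^sup>2 - (2 / \<theta>) * (t - t powr \<theta>) * q powr \<theta>"
  shows "a \<le> 1 / 2"
proof -
  have "t powr \<theta> \<le> t powr 2"
    using assms by (intro powr_mono') auto
  then have "t * (1 - t) \<le> t - t powr \<theta>"
    using assms by (simp add: powr_numeral power2_eq_square algebra_simps)
  then have "(2 / \<theta>) * (t * (1 - t)) * q powr \<theta> \<le> (2 / \<theta>) * (t - t powr \<theta>) * q powr \<theta>"
    using assms by (intro mult_left_mono mult_right_mono) auto
  with assms(5) have "2 * (1 - t) * a \<le> t * (1 - t) * q\<^sup>2 - (2 / \<theta>) * (t * (1 - t)) * q powr \<theta>"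
    by linarith
  also have "\<dots> = (1 - t) * (t * (q\<^sup>2 - (2 / \<theta>) * q powr \<theta>))"
    by (simp add: algebra_simps)
  also have "\<dots> \<le> (1 - t) * (t * 1)"
    using square_le_powr[of \<theta> q] assms by (intro mult_left_mono) auto
  finally have "(1 - t) * (2 * a) \<le> (1 - t) * t" by (simp add: algebra_simps)
  then show ?thesis using assms by simp
qed

lemma powr_diff_le:
  fixes a b :: real
  assumes "\<theta> \<ge> 1" "0 \<le> a" "0 \<le> b" "a \<le> M" "b \<le> M"
  shows "a powr \<theta> - b powr \<theta> \<le> \<theta> * M powr (\<theta> - 1) * \<bar>a - b\<bar>"
proof (cases "b < a")
  case True
  have "continuous_on {b..a} (\<lambda>x. x powr \<theta>)"
    using assms by (intro continuous_on_powr' continuous_intros) auto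
  moreover have "(\<lambda>x. x powr \<theta>) differentiable (at x)" if "b < x" "x < a" for x
    using that assms has_real_derivative_powr[of x \<theta>] real_differentiable_def by auto
  ultimately obtain l z where z: "b < z" "z < a" "((\<lambda>x. x powr \<theta>) has_real_derivative l) (at z)"
      "a powr \<theta> - b powr \<theta> = (a - b) * l"
    using MVT[OF True] by blast
  have "l = \<theta> * z powr (\<theta> - 1)"
    using DERIV_unique[OF z(3) has_real_derivative_powr[of z \<theta>]] z assms by simp
  also have "\<dots> \<le> \<theta> * M powr (\<theta> - 1)"
    using z assms by (intro mult_left_mono powr_mono2) auto
  finally show ?thesis
    using z(4) mult_left_mono[of l "\<theta> * M powr (\<theta> - 1)" "a - b"] True by (simp add: mult.commute)
next
  case False
  then have "a powr \<theta> \<le> b powr \<theta>" using assms by (intro powr_mono2) auto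
  then show ?thesis using assms by (smt (verit) mult_nonneg_nonneg powr_ge_zero abs_ge_zero)
qed

section \<open>Comparison of two solutions\<close>

text \<open>
  The function \<open>w = exp (- (\<psi> + c)) - exp (- \<phi>)\<close> is nonnegative exactly where \<open>\<phi> - \<psi> \<ge> c\<close>. A negative
  value of \<open>w\<close> would be surpassed near infinity, because \<open>exp (- \<phi>)\<close> vanishes there, so \<open>w\<close> would have
  a negative minimum. That point lies outside the ball, so \<open>f - lam2 > 1 / 2\<close> there, which
  \<open>exterior_gradient_inequality\<close> excludes.
\<close>

lemma difference_attains_min:
  fixes f \<phi> \<psi> :: "real ^ 'm::finite \<Rightarrow> real"
  assumes \<theta>: "\<theta> \<ge> 2" and f: "coercive f"
    and sol1: "is_solution_EP \<theta> f lam1 \<phi>" and sol2: "is_solution_EP \<theta> f lam2 \<psi>"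
    and bdd: "bdd_below (range \<phi>)" and lam: "lam1 \<le> lam2"
  shows "\<exists>x. \<forall>y. \<phi> x - \<psi> x \<le> \<phi> y - \<psi> y"
proof -
  have C2: "C2 \<phi>" "C2 \<psi>"
    and eq1: "\<And>y. laplacian \<phi> y = (2 / \<theta>) * norm (gradient \<phi> y) powr \<theta> - 2 * (f y - lam1)"
    and eq2: "\<And>y. laplacian \<psi> y = (2 / \<theta>) * norm (gradient \<psi> y) powr \<theta> - 2 * (f y - lam2)"
    using solution_C2_laplacian[OF sol1] solution_C2_laplacian[OF sol2] by blast+
  have cont: "continuous_on S \<phi>" "continuous_on S \<psi>" for S
    using C2 by (simp_all add: C2_def C1_imp_continuous_on)
  have "eventually (\<lambda>x. lam2 + 1 / 2 < f x) at_infinity"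
    using f by (simp add: coercive_def filterlim_at_top_dense)
  then obtain R0 where R0: "\<And>x. R0 \<le> norm x \<Longrightarrow> lam2 + 1 / 2 < f x"
    by (auto simp: eventually_at_infinity)
  define R where "R = max R0 0"
  have R: "lam2 + 1 / 2 < f x" if "R \<le> norm x" for x
    using R0 that by (simp add: R_def)
  have "R \<ge> 0" by (simp add: R_def)
  have "continuous_on (cball 0 R) (\<lambda>x. \<phi> x - \<psi> x)"
    by (intro continuous_intros cont)
  then obtain x1 where x1: "\<And>y. y \<in> cball 0 R \<Longrightarrow> \<phi> x1 - \<psi> x1 \<le> \<phi> y - \<psi> y"
    using continuous_attains_inf[of "cball 0 R" "\<lambda>x. \<phi> x - \<psi> x"] \<open>R \<ge> 0\<close> by force
  define c where "c = \<phi> x1 - \<psi> x1"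
  define w where "w x = exp (- (\<psi> x + c)) - exp (- \<phi> x)" for x
  have contw: "continuous_on S w" for S
    unfolding w_def by (intro continuous_intros cont)
  have "w y \<ge> 0" for y
  proof (rule ccontr)
    assume "\<not> w y \<ge> 0"
    then have wy: "w y < 0" by simp
    have "eventually (\<lambda>x. - ln (- w y) < \<phi> x) at_infinity"
      using solution_coercive[OF _ f sol1 bdd] \<theta> by (simp add: filterlim_at_top_dense)
    then obtain S0 where S0: "\<And>x. S0 \<le> norm x \<Longrightarrow> - ln (- w y) < \<phi> x"
      by (auto simp: eventually_at_infinity)
    have far: "w y < w x" if "S0 \<le> norm x" for x
    proof -
      have "exp (- \<phi> x) < exp (ln (- w y))" using S0[OF that] by simp
      also have "\<dots> = - w y" using wy by simp
      finally show ?thesis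
        using exp_gt_zero[of "- (\<psi> x + c)"] unfolding w_def by linarith
    qed
    have "y \<in> cball 0 S0" using far[of y] by force
    then have "compact (cball (0 :: real ^ 'm) S0)" "cball (0 :: real ^ 'm) S0 \<noteq> {}"
      by (blast intro: compact_cball)+
    then obtain p where p: "p \<in> cball 0 S0" "\<And>x. x \<in> cball 0 S0 \<Longrightarrow> w p \<le> w x"
      using continuous_attains_inf[of "cball 0 S0" w] contw by blast
    have pmin: "w p \<le> w x" for x
    proof (cases "norm x \<le> S0")
      case False
      then show ?thesis using far[of x] p(2)[OF \<open>y \<in> cball 0 S0\<close>] by simp
    qed (simp add: p)
    have "w p < 0" using pmin[of y] wy by simp
    then have less: "\<phi> p < \<psi> p + c" by (simp add: w_def)
    then have "R < norm p" using x1[of p] by (force simp: c_def)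
    define v1 v2 where "v1 = exp (- \<phi> p)" and "v2 = exp (- (\<psi> p + c))"
    have v: "0 < v2" "v2 < v1" using less by (simp_all add: v1_def v2_def)
    define dw where "dw i t =
        exp (- (\<psi> (p + t *\<^sub>R axis i 1) + c)) * - partial i \<psi> (p + t *\<^sub>R axis i 1)
        - exp (- \<phi> (p + t *\<^sub>R axis i 1)) * - partial i \<phi> (p + t *\<^sub>R axis i 1)" for i t
    define ddw where "ddw i = v2 * ((partial i \<psi> p)\<^sup>2 - partial i (partial i \<psi>) p)
        - v1 * ((partial i \<phi> p)\<^sup>2 - partial i (partial i \<phi>) p)" for i
    have d1: "((\<lambda>t. w (p + t *\<^sub>R axis i 1)) has_real_derivative dw i t) (at t)" for i t
      unfolding w_def dw_def
      by (rule derivative_eq_intros C2_line_derivatives[OF C2(1)] C2_line_derivatives[OF C2(2)] refl)+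
         simp
    have d2: "(dw i has_real_derivative ddw i) (at 0)" for i
      unfolding dw_def ddw_def v1_def v2_def
      by (rule derivative_eq_intros C2_line_derivatives[OF C2(1)] C2_line_derivatives[OF C2(2)] refl)+
         (simp add: power2_eq_square algebra_simps)
    note crit = coordinate_derivatives_local_min[where e = 1, OF _ pmin d1 d2]
    define t where "t = v2 / v1"
    have t: "0 < t" "t < 1" "v2 = t * v1" using v by (simp_all add: t_def)
    define q where "q = norm (gradient \<psi> p)"
    have "v1 *\<^sub>R gradient \<phi> p = v2 *\<^sub>R gradient \<psi> p"
      using crit(1) by (simp add: vec_eq_iff gradient_def dw_def v1_def v2_def algebra_simps)
    then have "v1 *\<^sub>R gradient \<phi> p = v1 *\<^sub>R t *\<^sub>R gradient \<psi> p"
      using t by (simp add: mult.commute)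
    then have "gradient \<phi> p = t *\<^sub>R gradient \<psi> p" using v by (subst (asm) scaleR_cancel_left) simp
    then have g: "norm (gradient \<phi> p) = t * q" using t by (simp add: q_def)
    have "0 \<le> (\<Sum>i\<in>UNIV. ddw i)" using crit(2) by (simp add: sum_nonneg)
    also have "\<dots> = v2 * (q\<^sup>2 - laplacian \<psi> p) - v1 * ((t * q)\<^sup>2 - laplacian \<phi> p)"
      unfolding ddw_def laplacian_def
      by (simp add: sum_subtractf sum_distrib_left[symmetric] sum_squares_gradient g q_def)
    also have "\<dots> = v1 * (t * (q\<^sup>2 - laplacian \<psi> p) - ((t * q)\<^sup>2 - laplacian \<phi> p))"
      by (simp add: t(3) algebra_simps)
    finally have "0 \<le> t * (q\<^sup>2 - laplacian \<psi> p) - ((t * q)\<^sup>2 - laplacian \<phi> p)"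
      using v by (simp add: zero_le_mult_iff)
    then have "2 * (f p - lam1) - 2 * t * (f p - lam2) \<le>
        t * (1 - t) * q\<^sup>2 - (2 / \<theta>) * (t - t powr \<theta>) * q powr \<theta>"
      unfolding eq1 eq2 g q_def[symmetric]
      using t by (simp add: powr_mult power2_eq_square algebra_simps diff_divide_distrib)
    moreover have "2 * (1 - t) * (f p - lam2) \<le> 2 * (f p - lam1) - 2 * t * (f p - lam2)"
      using lam by (simp add: algebra_simps)
    ultimately have "f p - lam2 \<le> 1 / 2"
      using exterior_gradient_inequality[OF \<theta> t(1,2), of q "f p - lam2"] by (simp add: q_def)
    then show False using R[of p] \<open>R < norm p\<close> by simp
  qed
  then have "\<phi> x1 - \<psi> x1 \<le> \<phi> y - \<psi> y" for y
    by (simp add: w_def c_def algebra_simps)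
  then show ?thesis by blast
qed

lemma eigenvalue_ge_at_min:
  assumes \<phi>: "is_solution_EP \<theta> f lam1 \<phi>" and \<psi>: "is_solution_EP \<theta> f lam2 \<psi>"
    and min: "\<And>y. \<phi> x - \<psi> x \<le> \<phi> y - \<psi> y"
  shows "lam2 \<le> lam1"
proof -
  have C2: "C2 (\<lambda>y. \<phi> y - \<psi> y)" "C2 \<phi>" "C2 \<psi>"
    using \<phi> \<psi> by (auto simp: is_solution_EP_def intro: C2_diff)
  note crit = coordinate_derivatives_local_min[where e = 1, OF _ min
      C2_line_derivatives(1)[OF C2(1)] C2_line_derivatives(2)[OF C2(1), where t = 0]]
  have "gradient (\<lambda>y. \<phi> y - \<psi> y) x = 0"
    using crit(1) by (simp add: gradient_def vec_eq_iff)
  moreover have "laplacian (\<lambda>y. \<phi> y - \<psi> y) x \<ge> 0"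
    using crit(2) by (simp add: laplacian_def sum_nonneg)
  ultimately have "gradient \<phi> x = gradient \<psi> x" "laplacian \<phi> x \<ge> laplacian \<psi> x"
    using C2 by (simp_all add: C2_diff)
  moreover have "- (1 / 2) * laplacian \<phi> x + (1 / \<theta>) * norm (gradient \<phi> x) powr \<theta> = f x - lam1"
    "- (1 / 2) * laplacian \<psi> x + (1 / \<theta>) * norm (gradient \<psi> x) powr \<theta> = f x - lam2"
    using \<phi> \<psi> by (simp_all add: is_solution_EP_def)
  ultimately show ?thesis by simp
qed

text \<open>
  Subtracting the equations leaves \<open>\<Delta>(\<phi> - \<psi>) = (2 / \<theta>) (|D\<phi>|^\<theta> - |D\<psi>|^\<theta>)\<close>. On a ball both gradients
  are bounded, and there \<open>powr_diff_le\<close> turns the right-hand side into a multiple of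
  \<open>|D\<phi> - D\<psi>|\<close>, as \<open>strong_minimum_principle\<close> requires.
\<close>

lemma solutions_differ_by_constant:
  fixes f \<phi> \<psi> :: "real ^ 'm::finite \<Rightarrow> real"
  assumes \<theta>: "\<theta> \<ge> 1"
    and sol1: "is_solution_EP \<theta> f lam \<phi>" and sol2: "is_solution_EP \<theta> f lam \<psi>"
    and min: "\<And>y. \<phi> x - \<psi> x \<le> \<phi> y - \<psi> y"
  shows "\<phi> y - \<psi> y = \<phi> x - \<psi> x"
proof -
  have C2: "C2 \<phi>" "C2 \<psi>"
    and eq1: "\<And>y. laplacian \<phi> y = (2 / \<theta>) * norm (gradient \<phi> y) powr \<theta> - 2 * (f y - lam)"
    and eq2: "\<And>y. laplacian \<psi> y = (2 / \<theta>) * norm (gradient \<psi> y) powr \<theta> - 2 * (f y - lam)"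
    using solution_C2_laplacian[OF sol1] solution_C2_laplacian[OF sol2] by blast+
  have "\<exists>C. \<forall>y\<in>cball z r. laplacian (\<lambda>y. \<phi> y - \<psi> y) y \<le> C * norm (gradient (\<lambda>y. \<phi> y - \<psi> y) y)"
    for z r
  proof -
    have bounded: "bounded (gradient u ` cball z r)" if "C2 u" for u :: "real ^ 'm \<Rightarrow> real"
      using that by (intro compact_imp_bounded compact_continuous_image
          C2_imp_continuous_on_gradient compact_cball)
    obtain M1 where M1: "\<And>y. y \<in> cball z r \<Longrightarrow> norm (gradient \<phi> y) \<le> M1"
      using bounded[OF C2(1)] unfolding bounded_iff by blast
    obtain M2 where M2: "\<And>y. y \<in> cball z r \<Longrightarrow> norm (gradient \<psi> y) \<le> M2"
      using bounded[OF C2(2)] unfolding bounded_iff by blast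
    define M where "M = max M1 M2"
    have "laplacian (\<lambda>y. \<phi> y - \<psi> y) y \<le> 2 * M powr (\<theta> - 1) * norm (gradient (\<lambda>y. \<phi> y - \<psi> y) y)"
      if y: "y \<in> cball z r" for y
    proof -
      let ?a = "norm (gradient \<phi> y)" and ?b = "norm (gradient \<psi> y)"
      have "?a powr \<theta> - ?b powr \<theta> \<le> \<theta> * M powr (\<theta> - 1) * \<bar>?a - ?b\<bar>"
        using powr_diff_le[OF \<theta>, of ?a ?b M] M1[OF y] M2[OF y] by (simp add: M_def)
      also have "\<dots> \<le> \<theta> * M powr (\<theta> - 1) * norm (gradient \<phi> y - gradient \<psi> y)"
        using \<theta> by (intro mult_left_mono norm_triangle_ineq3) auto
      finally have "(2 / \<theta>) * (?a powr \<theta> - ?b powr \<theta>)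
          \<le> (2 / \<theta>) * (\<theta> * M powr (\<theta> - 1) * norm (gradient \<phi> y - gradient \<psi> y))"
        using \<theta> by (intro mult_left_mono) auto
      also have "\<dots> = 2 * M powr (\<theta> - 1) * norm (gradient \<phi> y - gradient \<psi> y)"
        using \<theta> by simp
      finally show ?thesis
        by (simp add: C2_diff[OF C2] eq1 eq2 right_diff_distrib)
    qed
    then show ?thesis by blast
  qed
  from strong_minimum_principle[OF C2_diff(1)[OF C2] min this] show ?thesis .
qed

theorem theorem3p1:
  fixes \<theta> lam1 lam2 :: real
    and f \<phi> \<psi> :: "real ^ 'm::finite \<Rightarrow> real"
  assumes "\<theta> \<ge> 2"
    and "locally_Lipschitz f"
    and "coercive f"
    and "is_solution_EP \<theta> f lam1 \<phi>"
    and "is_solution_EP \<theta> f lam2 \<psi>"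
    and "bdd_below (range \<phi>)"
    and "bdd_below (range \<psi>)"
  shows "lam1 = lam2 \<and> (\<exists>C::real. \<forall>y. \<phi> y = \<psi> y + C)"
proof
  show lam: "lam1 = lam2"
  proof (cases "lam1 \<le> lam2")
    case True
    then obtain x where "\<And>y. \<phi> x - \<psi> x \<le> \<phi> y - \<psi> y"
      using difference_attains_min[OF assms(1,3,4,5,6)] by blast
    then show ?thesis using eigenvalue_ge_at_min[OF assms(4,5)] True by force
  next
    case False
    then obtain x where "\<And>y. \<psi> x - \<phi> x \<le> \<psi> y - \<phi> y"
      using difference_attains_min[OF assms(1,3,5,4,7)] by force
    then show ?thesis using eigenvalue_ge_at_min[OF assms(5,4)] False by force
  qed
  obtain x where "\<And>y. \<phi> x - \<psi> x \<le> \<phi> y - \<psi> y"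
    using difference_attains_min[OF assms(1,3,4,5,6)] lam by blast
  then have "\<phi> y - \<psi> y = \<phi> x - \<psi> x" for y
    using solutions_differ_by_constant[of \<theta> f lam1 \<phi> \<psi> x y] assms lam by auto
  then show "\<exists>C. \<forall>y. \<phi> y = \<psi> y + C"
    by (intro exI[of _ "\<phi> x - \<psi> x"]) (simp add: algebra_simps)
qed

end
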